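(* Let $G$ be a weighted graph and let $a,b$ be identical twins in $G$. Let $G'$ be the weighted graph obtained from $G-b$ by changing the weights of $a$ to \[ \beta'(a)=\beta(a)\beta(b),\qquad \alpha'(a)=\alpha(a)\beta(b)+\alpha(a)\alpha(b)(y-1)+\beta(a)\alpha(b), \] all other vertices keeping their weights. Then $q(G)=q(G')$.
   Context: All graphs are finite and may have loops (at most one per vertex) but no multiple edges. The adjacency matrix of a graph is the symmetric $0/1$ matrix over $GF(2)$ whose diagonal entry at $v$ is $1$ iff $v$ is looped; $r(G)$ and $n(G)$ denote its rank and nullity over $GF(2)$ (the empty graph has $r=n=0$). For $S\subseteq V(G)$, $G[S]$ is the induced subgraph. Let $A$ be a commutative ring with unity containing elements $x,y$. A weighted graph is a graph $G$ together with functions $\alpha,\beta:V(G)\to A$, and its weighted interlace polynomial is \[ q(G)=\sum_{S\subseteq V(G)}\Big(\prod_{s\in S}\alpha(s)\Big)\Big(\prod_{v\notin S}\beta(v)\Big)(x-1)^{r(G[S])}(y-1)^{n(G[S])}. \] Two distinct vertices $a,b$ are identical twins if (i) either both are looped and they are adjacent, or both are unlooped and they are not adjacent, and (ii) they have the same neighbors outside $\{a,b\}$. *)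

theory Defs
  imports Complex_Main "HOL-Library.Z2" "HOL-Library.Function_Algebras"
begin

record 'v graph =
  verts :: "'v set"
  adj :: "'v \<Rightarrow> 'v \<Rightarrow> bool"

record ('v, 'a) weighted_graph = "'v graph" +
  alpha :: "'v \<Rightarrow> 'a"
  beta :: "'v \<Rightarrow> 'a"

text \<open>A loop at \<open>v\<close> is expressed by \<open>adj G v v\<close>.\<close>

definition wf_graph :: "('v, 'm) graph_scheme \<Rightarrow> bool" where
  "wf_graph G \<longleftrightarrow> finite (verts G) \<and>
     (\<forall>u v. adj G u v \<longrightarrow> u \<in> verts G \<and> v \<in> verts G) \<and>
     (\<forall>u v. adj G u v \<longrightarrow> adj G v u)"

text \<open>Intended for \<open>S \<subseteq> verts G\<close>. Vertex weights, if present, are kept.\<close>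

definition induced :: "('v, 'm) graph_scheme \<Rightarrow> 'v set \<Rightarrow> ('v, 'm) graph_scheme" where
  "induced G S = G\<lparr>verts := S, adj := (\<lambda>u v. u \<in> S \<and> v \<in> S \<and> adj G u v)\<rparr>"

definition del_vert :: "('v, 'm) graph_scheme \<Rightarrow> 'v \<Rightarrow> ('v, 'm) graph_scheme" where
  "del_vert G v = induced G (verts G - {v})"

text \<open>The type \<open>bit\<close> is the field GF(2). A vector indexed by a vertex set is a function
  on the whole vertex type that vanishes outside that set.\<close>

global_interpretation gf2: vector_space "\<lambda>(c::bit) (f::'v \<Rightarrow> bit) v. c * f v"
  by unfold_locales (auto simp: fun_eq_iff algebra_simps)

definition adj_matrix :: "('v, 'm) graph_scheme \<Rightarrow> 'v \<Rightarrow> 'v \<Rightarrow> bit" where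
  "adj_matrix G u v = of_bool (adj G u v)"

text \<open>Rank is the dimension of the column space, nullity the dimension of the kernel.\<close>

definition graph_rank :: "('v, 'm) graph_scheme \<Rightarrow> nat" where
  "graph_rank G = gf2.dim ((\<lambda>v u. adj_matrix G u v) ` verts G)"

definition graph_nullity :: "('v, 'm) graph_scheme \<Rightarrow> nat" where
  "graph_nullity G = gf2.dim {f. (\<forall>v. v \<notin> verts G \<longrightarrow> f v = 0) \<and>
     (\<forall>u\<in>verts G. (\<Sum>v\<in>verts G. adj_matrix G u v * f v) = 0)}"

text \<open>The sort \<open>{comm_ring, comm_monoid_mult}\<close> is that of commutative rings with unity;
  unlike \<open>comm_ring_1\<close> it does not exclude the zero ring.\<close>

definition interlace_poly ::
  "'a::{comm_ring, comm_monoid_mult} \<Rightarrow> 'a \<Rightarrow> ('v, 'a) weighted_graph \<Rightarrow> 'a" where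
  "interlace_poly x y G = (\<Sum>S\<in>Pow (verts G).
     (\<Prod>s\<in>S. alpha G s) * (\<Prod>v\<in>verts G - S. beta G v) *
     (x - 1) ^ graph_rank (induced G S) * (y - 1) ^ graph_nullity (induced G S))"

definition identical_twins :: "('v, 'm) graph_scheme \<Rightarrow> 'v \<Rightarrow> 'v \<Rightarrow> bool" where
  "identical_twins G a b \<longleftrightarrow> a \<in> verts G \<and> b \<in> verts G \<and> a \<noteq> b \<and>
     (adj G a a \<and> adj G b b \<and> adj G a b \<or> \<not> adj G a a \<and> \<not> adj G b b \<and> \<not> adj G a b) \<and>
     (\<forall>c\<in>verts G - {a, b}. adj G a c \<longleftrightarrow> adj G b c)"

end

(* Twins have equal rows and columns in the adjacency matrix. For S avoiding a and b, the sets
   S + a and S + b therefore induce isomorphic graphs, while adjoining b to S + a repeats a column: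
   the rank stays the same and the kernel gains the vector e_a + e_b. Hence the four terms of q(G)
   for S, S + a, S + b, S + a + b add up to the two terms of q(G') for S and S + a. *)

theory Submission
  imports Defs "HOL-Combinatorics.Transposition"
begin

text \<open>These default rules rewrite field operations to bit operations.\<close>

declare add_bit_eq_xor [simp del] mult_bit_eq_and [simp del] minus_bit_def [simp del]

section \<open>Dimension under linear images and under adjoining a vector\<close>

text \<open>A basis chosen inside \<open>S\<close> is mapped to a basis of the image. Injectivity is
  asked only on the span because the map that duplicates a twin coordinate is not injective on all
  vectors.\<close>

lemma (in Vector_Spaces.linear) dim_image_inj_on_span:
  assumes "inj_on f (vs1.span S)"
  shows "vs2.dim (f ` S) = vs1.dim S"
proof -
  obtain B where B: "B \<subseteq> S" "vs1.independent B" "S \<subseteq> vs1.span B" "card B = vs1.dim S"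
    by (rule vs1.basis_exists)
  have inj: "inj_on f (vs1.span B)"
    using assms vs1.span_mono[OF B(1)] by (rule inj_on_subset)
  show ?thesis
  proof (rule vs2.dim_unique)
    show "f ` B \<subseteq> f ` S" using B(1) by blast
    show "f ` S \<subseteq> vs2.span (f ` B)" using B(3) span_image by blast
    show "vs2.independent (f ` B)" by (rule independent_inj_on_image[OF B(2) inj])
    show "card (f ` B) = vs1.dim S"
      using card_image[OF inj_on_subset[OF inj vs1.span_superset]] B(4) by simp
  qed
qed

lemma gf2_linearI:
  fixes L :: "('v \<Rightarrow> bit) \<Rightarrow> 'w \<Rightarrow> bit"
  assumes "\<And>f g. L (f + g) = L f + L g" and "\<And>c f. L (\<lambda>v. c * f v) = (\<lambda>v. c * L f v)"
  shows "Vector_Spaces.linear (\<lambda>c f v. c * f v) (\<lambda>c f v. c * f v) L"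
  by unfold_locales (use assms in auto)

text \<open>A basis chosen inside \<open>V\<close> stays independent when \<open>e\<close> is
  adjoined. Finiteness of \<open>V\<close> makes this basis finite, so that its cardinality really
  grows by one.\<close>

lemma gf2_dim_insert:
  assumes "finite V" and "e \<notin> gf2.span V"
  shows "gf2.dim (insert e V) = Suc (gf2.dim V)"
proof -
  obtain B where B: "B \<subseteq> V" "gf2.independent B" "V \<subseteq> gf2.span B" "card B = gf2.dim V"
    by (rule gf2.basis_exists)
  have e: "e \<notin> gf2.span B" using assms(2) gf2.span_mono[OF B(1)] by blast
  show ?thesis
  proof (rule gf2.dim_unique)
    show "insert e B \<subseteq> insert e V" using B(1) by blast
    show "insert e V \<subseteq> gf2.span (insert e B)"
      using B(3) gf2.span_mono[of B "insert e B"] gf2.span_base[of e "insert e B"] by blast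
    show "gf2.independent (insert e B)" by (rule gf2.independent_insertI[OF e B(2)])
    show "card (insert e B) = Suc (gf2.dim V)"
      using e gf2.span_base[of e B] finite_subset[OF B(1) assms(1)] B(4)
      by (metis card_insert_disjoint)
  qed
qed

section \<open>Kernels, and invariance of rank and nullity under isomorphism\<close>

definition adj_kernel :: "('v, 'm) graph_scheme \<Rightarrow> ('v \<Rightarrow> bit) set" where
  "adj_kernel G = {f. (\<forall>v. v \<notin> verts G \<longrightarrow> f v = 0) \<and>
     (\<forall>u\<in>verts G. (\<Sum>v\<in>verts G. adj_matrix G u v * f v) = 0)}"

lemma graph_nullity_eq: "graph_nullity G = gf2.dim (adj_kernel G)"
  by (simp add: graph_nullity_def adj_kernel_def)

lemma finite_adj_kernel:
  assumes "finite (verts G)"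
  shows "finite (adj_kernel G)"
proof (rule finite_subset)
  have "finite (UNIV :: bit set)" 
    by (rule finite_subset[of _ "{0, 1}"]) (auto intro: bit.exhaust)
  then show "finite {f. \<forall>v. (v \<in> verts G \<longrightarrow> f v \<in> (UNIV :: bit set)) \<and> (v \<notin> verts G \<longrightarrow> f v = 0)}"
    by (rule finite_set_of_finite_funs[OF assms])
qed (auto simp: adj_kernel_def)

lemma graph_rank_nullity_cong:
  assumes "verts H = verts G" and "adj H = adj G"
  shows "graph_rank H = graph_rank G" "graph_nullity H = graph_nullity G"
  by (simp_all add: graph_rank_def graph_nullity_def adj_matrix_def assms)

text \<open>Relabelling coordinates along \<open>p\<close> is an injective linear map
  \<open>L\<close> that carries columns to columns and kernel vectors to kernel vectors.\<close>

lemma graph_rank_nullity_iso: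
  assumes "bij p" and "verts H = p ` verts G" and "\<And>u v. adj H (p u) (p v) \<longleftrightarrow> adj G u v"
  shows "graph_rank H = graph_rank G" "graph_nullity H = graph_nullity G"
proof -
  define L :: "('a \<Rightarrow> bit) \<Rightarrow> 'b \<Rightarrow> bit" where "L f = f \<circ> inv p" for f
  have p: "inv p (p v) = v" "p (inv p w) = w" for v w
    using assms(1) by (simp_all add: bij_is_inj bij_is_surj surj_f_inv_f)
  interpret L: Vector_Spaces.linear "\<lambda>c f v. c * f v" "\<lambda>c f v. c * f v" L
    by (rule gf2_linearI) (auto simp: L_def fun_eq_iff)
  have inj: "inj_on L A" for A
    by (rule inj_on_inverseI[where g = "\<lambda>f. f \<circ> p"]) (simp add: L_def fun_eq_iff p)
  have mat: "adj_matrix H (p u) (p v) = adj_matrix G u v" for u v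
    by (simp add: adj_matrix_def assms(3))
  have col: "(\<lambda>u. adj_matrix H u (p v)) = L (\<lambda>u. adj_matrix G u v)" for v
    using mat[of "inv p _" v] by (simp add: L_def fun_eq_iff p)
  have "(\<lambda>v u. adj_matrix H u v) ` verts H = L ` (\<lambda>v u. adj_matrix G u v) ` verts G"
    by (simp add: assms(2) image_image col)
  then show "graph_rank H = graph_rank G"
    by (simp add: graph_rank_def L.dim_image_inj_on_span[OF inj])
  have p_inj: "inj_on p A" for A using assms(1) by (meson bij_is_inj inj_on_subset subset_UNIV)
  have mem: "w \<in> verts H \<longleftrightarrow> inv p w \<in> verts G" for w
    unfolding assms(2) image_iff using p by metis
  have ker: "L f \<in> adj_kernel H \<longleftrightarrow> f \<in> adj_kernel G" for f
  proof -
    have "(\<forall>w. w \<notin> verts H \<longrightarrow> L f w = 0) \<longleftrightarrow> (\<forall>v. v \<notin> verts G \<longrightarrow> f v = 0)"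
    proof (intro iffI allI impI)
      fix v assume "\<forall>w. w \<notin> verts H \<longrightarrow> L f w = 0" and "v \<notin> verts G"
      from spec[OF this(1), of "p v"] this(2) show "f v = 0"
        by (simp add: L_def mem p(1))
    qed (simp add: L_def mem)
    then show ?thesis
      by (simp add: adj_kernel_def assms(2) sum.reindex[OF p_inj] mat L_def p)
  qed
  have "adj_kernel H = L ` adj_kernel G"
  proof (intro set_eqI iffI)
    fix f assume "f \<in> adj_kernel H"
    moreover have "f = L (f \<circ> p)" by (simp add: L_def fun_eq_iff p)
    ultimately show "f \<in> L ` adj_kernel G" using ker by (metis image_eqI)
  qed (use ker in auto)
  then show "graph_nullity H = graph_nullity G"
    by (simp add: graph_nullity_eq L.dim_image_inj_on_span[OF inj])
qed

section \<open>Rank and nullity in the presence of twins\<close>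

text \<open>Condition (i) and symmetry make the four entries indexed by \<open>a\<close> and
  \<open>b\<close> equal, condition (ii) handles the other vertices, and outside
  \<open>verts G\<close> there are no adjacencies.\<close>

lemma identical_twins_adj:
  assumes "wf_graph G" and "identical_twins G a b"
  shows "adj G b u \<longleftrightarrow> adj G a u" "adj G u b \<longleftrightarrow> adj G u a"
  using assms unfolding wf_graph_def identical_twins_def by (metis DiffI insertE singletonD)+

text \<open>Transposing the twins preserves adjacency in \<open>G\<close>, fixes \<open>T\<close>
  pointwise and sends \<open>a\<close> to \<open>b\<close>.\<close>

lemma twins_swap:
  assumes "wf_graph G" and "identical_twins G a b" and "a \<notin> T" and "b \<notin> T"
  shows "graph_rank (induced G (insert b T)) = graph_rank (induced G (insert a T))"
    and "graph_nullity (induced G (insert b T)) = graph_nullity (induced G (insert a T))"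
proof -
  let ?p = "transpose a b"
  have ab: "a \<noteq> b" using assms(2) by (simp add: identical_twins_def)
  have verts: "verts (induced G (insert b T)) = ?p ` verts (induced G (insert a T))"
    using assms(3,4) by (auto simp: induced_def transpose_def image_iff)
  have adj: "adj (induced G (insert b T)) (?p u) (?p v) \<longleftrightarrow> adj (induced G (insert a T)) u v" for u v
    using ab assms(3,4) identical_twins_adj[OF assms(1,2)]
    by (auto simp: induced_def transpose_def)
  show "graph_rank (induced G (insert b T)) = graph_rank (induced G (insert a T))"
    and "graph_nullity (induced G (insert b T)) = graph_nullity (induced G (insert a T))"
    using graph_rank_nullity_iso[OF bij_transpose verts adj] by simp_all
qed

lemma graph_rank_insert_twin:
  assumes "wf_graph G" and "identical_twins G a b" and "a \<in> S" and "b \<notin> S"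
  shows "graph_rank (induced G (insert b S)) = graph_rank (induced G S)"
proof -
  note tw = identical_twins_adj[OF assms(1,2)]
  \<comment> \<open>Rows \<open>a\<close> and \<open>b\<close> agree, so copying entry
    \<open>a\<close> into coordinate \<open>b\<close> turns a column for \<open>S\<close> into the
    corresponding column for \<open>insert b S\<close>.\<close>
  define L :: "('a \<Rightarrow> bit) \<Rightarrow> 'a \<Rightarrow> bit" where "L f = f(b := f a)" for f
  let ?C = "\<lambda>S v u. adj_matrix (induced G S) u v"
  interpret L: Vector_Spaces.linear "\<lambda>c f v. c * f v" "\<lambda>c f v. c * f v" L
    by (rule gf2_linearI) (auto simp: L_def fun_eq_iff)
  \<comment> \<open>The columns for \<open>S\<close> vanish at \<open>b\<close>, hence so does their
    span; there \<open>L\<close> is undone by resetting coordinate \<open>b\<close> to 0.\<close>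
  have "gf2.subspace {f :: 'a \<Rightarrow> bit. f b = 0}"
    by (auto simp: gf2.subspace_def)
  moreover have "?C S ` S \<subseteq> {f. f b = 0}"
    using assms(4) by (auto simp: adj_matrix_def induced_def)
  ultimately have "gf2.span (?C S ` S) \<subseteq> {f. f b = 0}"
    by (rule gf2.span_minimal[rotated])
  moreover have "inj_on L {f. f b = 0}"
    by (rule inj_on_inverseI[where g = "\<lambda>f. f(b := 0)"]) (auto simp: L_def fun_eq_iff)
  ultimately have inj: "inj_on L (gf2.span (?C S ` S))"
    by (rule inj_on_subset[rotated])
  have "?C (insert b S) b = ?C (insert b S) a"
    using assms(3) tw by (auto simp: adj_matrix_def induced_def fun_eq_iff)
  then have "?C (insert b S) ` insert b S = ?C (insert b S) ` S"
    using assms(3) by auto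
  also have "\<dots> = L ` ?C S ` S"
    unfolding image_image
    by (rule image_cong) (use assms(3,4) tw in \<open>auto simp: L_def adj_matrix_def induced_def fun_eq_iff\<close>)
  finally show ?thesis
    using L.dim_image_inj_on_span[OF inj] by (simp add: graph_rank_def induced_def)
qed

text \<open>The kernel for \<open>S\<close> consists of the vectors vanishing at \<open>b\<close> in
  the kernel for \<open>insert b S\<close>, and one further vector, nonzero at \<open>b\<close>,
  spans the rest.\<close>

lemma graph_nullity_insert_twin:
  assumes "wf_graph G" and "identical_twins G a b" and "finite S" and "a \<in> S" and "b \<notin> S"
  shows "graph_nullity (induced G (insert b S)) = Suc (graph_nullity (induced G S))"
proof -
  note tw = identical_twins_adj[OF assms(1,2)]
  let ?K = "adj_kernel (induced G S)" and ?K' = "adj_kernel (induced G (insert b S))"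
  \<comment> \<open>Using the matrix of \<open>G\<close> itself, without membership tests, lets both
    kernels be described by the same entries.\<close>
  define m :: "'a \<Rightarrow> 'a \<Rightarrow> bit" where "m u v = of_bool (adj G u v)" for u v
  have ker: "adj_kernel (induced G T) =
    {f. (\<forall>v. v \<notin> T \<longrightarrow> f v = 0) \<and> (\<forall>u\<in>T. (\<Sum>v\<in>T. m u v * f v) = 0)}" for T
    by (auto simp: adj_kernel_def induced_def adj_matrix_def m_def)
  have m: "m b v = m a v" "m u b = m u a" for u v by (simp_all add: m_def tw)
  \<comment> \<open>This is the indicator of the twin pair; it is a kernel vector because two equal
    columns cancel in characteristic 2.\<close>
  define e :: "'a \<Rightarrow> bit" where "e v = of_bool (v = a) + of_bool (v = b)" for v
  have ab: "a \<noteq> b" using assms(4,5) by blast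
  have e_b: "e b = 1" using ab by (simp add: e_def)
  have e_sum: "(\<Sum>v\<in>insert b S. m u v * e v) = 0" for u
  proof -
    have "m u v * e v = (if v = a then m u a else 0) + (if v = b then m u b else 0)" for v
      by (simp add: e_def)
    then have "(\<Sum>v\<in>insert b S. m u v * e v) = m u a + m u b"
      using assms(3,4) by (simp add: sum.distrib del: sum.insert)
    then show ?thesis by (cases "m u a") (simp_all add: m)
  qed
  have sub_K': "gf2.subspace ?K'"
    by (auto simp: gf2.subspace_def ker distrib_left sum.distrib mult.left_commute
        simp flip: sum_distrib_left simp del: sum.insert)
  \<comment> \<open>With \<open>f b = 0\<close> the extra summand disappears, and the extra equation
    at row \<open>b\<close> repeats the one at row \<open>a\<close>.\<close>
  have K: "?K = {f \<in> ?K'. f b = 0}"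
    using assms(3-5) by (auto simp: ker m)
  have e_K': "e \<in> ?K'" using e_sum assms(4) by (auto simp: ker e_def simp del: sum.insert)
  have span_K: "gf2.span ?K \<subseteq> {f. f b = 0}"
    by (rule gf2.span_minimal) (auto simp: K gf2.subspace_def)
  have "?K' \<subseteq> gf2.span (insert e ?K)"
  proof
    fix f assume f: "f \<in> ?K'"
    \<comment> \<open>Since \<open>e b = 1\<close>, this multiple of \<open>e\<close> clears
      coordinate \<open>b\<close>.\<close>
    have "f - (\<lambda>v. f b * e v) \<in> ?K'"
      by (intro gf2.subspace_diff[OF sub_K' f] gf2.subspace_scale[OF sub_K' e_K'])
    then have "f - (\<lambda>v. f b * e v) \<in> ?K" by (simp add: K e_b)
    then show "f \<in> gf2.span (insert e ?K)"
      unfolding gf2.span_breakdown_eq using gf2.span_base by blast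
  qed
  moreover have "insert e ?K \<subseteq> ?K'" using e_K' K by blast
  ultimately have "gf2.span ?K' = gf2.span (insert e ?K)"
    using gf2.span_mono[of "insert e ?K" ?K']
      gf2.span_minimal[OF _ gf2.subspace_span, of ?K' "insert e ?K"] by blast
  then have "gf2.dim ?K' = gf2.dim (insert e ?K)" by (rule gf2.span_eq_dim)
  also have "\<dots> = Suc (gf2.dim ?K)"
  proof (rule gf2_dim_insert)
    show "finite ?K" by (rule finite_adj_kernel) (simp add: induced_def assms(3))
    show "e \<notin> gf2.span ?K" using span_K e_b by auto
  qed
  finally show ?thesis by (simp add: graph_nullity_eq)
qed

text \<open>Subsets are sorted by whether they contain \<open>a\<close>. Used for both twins, this
  groups the terms for \<open>G\<close> in fours, indexed by the subsets avoiding them.\<close>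

lemma sum_Pow_insert:
  assumes "finite A" and "a \<notin> A"
  shows "sum f (Pow (insert a A)) = (\<Sum>S\<in>Pow A. f S + f (insert a S))"
proof -
  have "inj_on (insert a) (Pow A)"
    using assms(2) by (intro inj_onI) (metis PowD insert_ident subsetD)
  moreover have "Pow A \<inter> insert a ` Pow A = {}" using assms(2) by auto
  ultimately show ?thesis
    using assms(1) by (simp add: Pow_insert sum.union_disjoint sum.reindex sum.distrib)
qed

theorem theorem3:
  fixes G G' :: "('v, 'a::{comm_ring, comm_monoid_mult}) weighted_graph"
    and x y :: 'a and a b :: 'v
  assumes "wf_graph G"
    and "identical_twins G a b"
    and "G' = (del_vert G b)
      \<lparr>alpha := (alpha G)(a := alpha G a * beta G b + alpha G a * alpha G b * (y - 1)
                              + beta G a * alpha G b),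
       beta := (beta G)(a := beta G a * beta G b)\<rparr>"
  shows "interlace_poly x y G = interlace_poly x y G'"
proof -
  define W where "W = verts G - {a, b}"
  have ab: "a \<noteq> b" and V: "verts G = insert b (insert a W)"
    using assms(2) by (auto simp: identical_twins_def W_def)
  have W: "finite W" "a \<notin> W" "b \<notin> W"
    using assms(1) by (auto simp: wf_graph_def W_def)
  have V': "verts G' = insert a W"
    using ab W by (auto simp: assms(3) del_vert_def induced_def V)
  define t where "t G S = (\<Prod>s\<in>S. alpha G s) * (\<Prod>v\<in>verts G - S. beta G v) *
     (x - 1) ^ graph_rank (induced G S) * (y - 1) ^ graph_nullity (induced G S)"
    for G :: "('v, 'a) weighted_graph" and S
  have q: "interlace_poly x y H = sum (t H) (Pow (verts H))" for H
    by (simp add: interlace_poly_def t_def)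
  \<comment> \<open>Weights do not affect rank and nullity, and deleting \<open>b\<close> does not
    change the subgraph induced on a set without \<open>b\<close>.\<close>
  have m': "graph_rank (induced G' S) = graph_rank (induced G S)"
    "graph_nullity (induced G' S) = graph_nullity (induced G S)" if "S \<subseteq> insert a W" for S
  proof -
    have "adj (induced G' S) = adj (induced G S)"
      using that ab W by (auto simp: assms(3) del_vert_def induced_def V fun_eq_iff)
    moreover have "verts (induced G' S) = verts (induced G S)" by (simp add: induced_def)
    ultimately show "graph_rank (induced G' S) = graph_rank (induced G S)"
      "graph_nullity (induced G' S) = graph_nullity (induced G S)"
      using graph_rank_nullity_cong[of "induced G' S" "induced G S"] by blast+
  qed
  \<comment> \<open>The set \<open>T\<close> yields the weight \<open>beta G a * beta G b\<close>.
    The other three sets share the powers belonging to \<open>insert a T\<close>, and their weights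
    add up to \<open>alpha G' a\<close>; the factor \<open>y - 1\<close> comes from the extra
    nullity when both twins are present.\<close>
  have terms: "t G T + t G (insert a T) + (t G (insert b T) + t G (insert b (insert a T)))
      = t G' T + t G' (insert a T)" if T: "T \<subseteq> W" for T
  proof -
    have fin: "finite T" "finite (W - T)" and nin: "a \<notin> T" "b \<notin> T"
      using T W finite_subset by auto
    have diffs: "verts G - T = insert b (insert a (W - T))"
      "verts G - insert a T = insert b (W - T)" "verts G - insert b T = insert a (W - T)"
      "verts G - insert b (insert a T) = W - T"
      "verts G' - T = insert a (W - T)" "verts G' - insert a T = W - T"
      using T W ab by (auto simp: V V')
    have w': "alpha G' v = alpha G v" "beta G' v = beta G v" if "v \<noteq> a" for v
      using that by (simp_all add: assms(3) del_vert_def induced_def)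
    have wa: "alpha G' a = alpha G a * beta G b + alpha G a * alpha G b * (y - 1) + beta G a * alpha G b"
      "beta G' a = beta G a * beta G b"
      by (simp_all add: assms(3))
    have prods: "(\<Prod>s\<in>T. alpha G' s) = (\<Prod>s\<in>T. alpha G s)"
      "(\<Prod>v\<in>W - T. beta G' v) = (\<Prod>v\<in>W - T. beta G v)"
      by (rule prod.cong; use w' nin W in force)+
    have ranks:
      "graph_rank (induced G (insert b T)) = graph_rank (induced G (insert a T))"
      "graph_nullity (induced G (insert b T)) = graph_nullity (induced G (insert a T))"
      "graph_rank (induced G (insert b (insert a T))) = graph_rank (induced G (insert a T))"
      "graph_nullity (induced G (insert b (insert a T))) = Suc (graph_nullity (induced G (insert a T)))"
      using twins_swap[OF assms(1,2) nin] fin nin ab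
      by (auto intro!: graph_rank_insert_twin[OF assms(1,2)] graph_nullity_insert_twin[OF assms(1,2)])
    have sub: "T \<subseteq> insert a W" "insert a T \<subseteq> insert a W" using T by auto
    show ?thesis
      unfolding t_def diffs m'[OF sub(1)] m'[OF sub(2)] ranks
      using fin nin W ab by (simp add: prods wa) (simp add: algebra_simps)
  qed
  have "interlace_poly x y G = (\<Sum>T\<in>Pow W. t G T + t G (insert a T)
      + (t G (insert b T) + t G (insert b (insert a T))))"
    using W ab by (simp add: q V sum_Pow_insert sum.distrib)
  also have "\<dots> = (\<Sum>T\<in>Pow W. t G' T + t G' (insert a T))"
    by (rule sum.cong) (use terms in auto)
  also have "\<dots> = interlace_poly x y G'"
    using W by (simp add: q V' sum_Pow_insert)
  finally show ?thesis .
qed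

end
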